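(* Let $X$ be a Tychonoff space. Then the following assertions are equivalent: (i) $X$ is a $P$-space; (ii) $C_p(X)$ is separably quasi-complete; (iii) $C_p(X)$ is sequentially complete; (iv) $C_p(X)$ is locally complete.
   Context: $\mathbb{F}$ denotes $\mathbb{R}$ or $\mathbb{C}$. A Tychonoff space is a completely regular $T_1$ space; it is a $P$-space if any countable intersection of open sets is open. $C_p(X)$ is the vector space of all continuous $\mathbb{F}$-valued functions on $X$ endowed with the topology of pointwise convergence. A locally convex space $E$ is: separably quasi-complete if every closed separable bounded subset of $E$ is complete; sequentially complete if each Cauchy sequence in $E$ converges; locally complete if the closed absolutely convex hull of every null sequence in $E$ is compact. *)

theory Defs
  imports "HOL-Analysis.Analysis"
begin

definition tychonoff_space :: "'a topology \<Rightarrow> bool"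
  where "tychonoff_space X \<longleftrightarrow> completely_regular_space X \<and> t1_space X"

definition P_space :: "'a topology \<Rightarrow> bool"
  where "P_space X \<longleftrightarrow> tychonoff_space X \<and>
    (\<forall>\<U>. countable \<U> \<and> \<U> \<noteq> {} \<and> (\<forall>U\<in>\<U>. openin X U) \<longrightarrow> openin X (\<Inter>\<U>))"


text \<open>A topological vector space over the scalars \<open>'f\<close>, given as a structure because function
  spaces such as $C_p(X)$ depend on the term \<open>X\<close>. The underlying set is the \<open>topspace\<close> of the
  topology; the operations are only meaningful on it. The notions below are meant for locally convex
  spaces. Open neighbourhoods of zero are used as a base of neighbourhoods.\<close>

record ('f, 'v) tvs =
  vtop :: "'v topology"
  vadd :: "'v \<Rightarrow> 'v \<Rightarrow> 'v"
  vzero :: 'v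
  vscale :: "'f \<Rightarrow> 'v \<Rightarrow> 'v"

definition vminus :: "('f::real_normed_field, 'v) tvs \<Rightarrow> 'v \<Rightarrow> 'v \<Rightarrow> 'v"
  where "vminus E x y = vadd E x (vscale E (- 1) y)"

definition zero_nbhd :: "('f, 'v) tvs \<Rightarrow> 'v set \<Rightarrow> bool"
  where "zero_nbhd E U \<longleftrightarrow> openin (vtop E) U \<and> vzero E \<in> U"

definition tvs_bounded :: "('f::real_normed_field, 'v) tvs \<Rightarrow> 'v set \<Rightarrow> bool"
  where "tvs_bounded E B \<longleftrightarrow> B \<subseteq> topspace (vtop E) \<and>
    (\<forall>U. zero_nbhd E U \<longrightarrow> (\<exists>r>0. \<forall>t::'f. norm t \<ge> r \<longrightarrow> B \<subseteq> vscale E t ` U))"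

text \<open>Completeness is expressed with filters rather than nets.\<close>

definition tvs_cauchy_filter :: "('f::real_normed_field, 'v) tvs \<Rightarrow> 'v filter \<Rightarrow> bool"
  where "tvs_cauchy_filter E F \<longleftrightarrow>
    (\<forall>U. zero_nbhd E U \<longrightarrow>
      (\<exists>S. eventually (\<lambda>x. x \<in> S) F \<and> (\<forall>x\<in>S. \<forall>y\<in>S. vminus E x y \<in> U)))"

definition tvs_complete :: "('f::real_normed_field, 'v) tvs \<Rightarrow> 'v set \<Rightarrow> bool"
  where "tvs_complete E A \<longleftrightarrow> A \<subseteq> topspace (vtop E) \<and>
    (\<forall>F. F \<noteq> bot \<and> F \<le> principal A \<and> tvs_cauchy_filter E F \<longrightarrow>
      (\<exists>a\<in>A. limitin (vtop E) (\<lambda>x. x) a F))"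

definition tvs_Cauchy :: "('f::real_normed_field, 'v) tvs \<Rightarrow> (nat \<Rightarrow> 'v) \<Rightarrow> bool"
  where "tvs_Cauchy E s \<longleftrightarrow> range s \<subseteq> topspace (vtop E) \<and>
    (\<forall>U. zero_nbhd E U \<longrightarrow> (\<exists>N. \<forall>m\<ge>N. \<forall>n\<ge>N. vminus E (s m) (s n) \<in> U))"

definition null_sequence :: "('f, 'v) tvs \<Rightarrow> (nat \<Rightarrow> 'v) \<Rightarrow> bool"
  where "null_sequence E s \<longleftrightarrow>
    range s \<subseteq> topspace (vtop E) \<and> limitin (vtop E) s (vzero E) sequentially"

definition absolutely_convex :: "('f::real_normed_field, 'v) tvs \<Rightarrow> 'v set \<Rightarrow> bool"
  where "absolutely_convex E C \<longleftrightarrow> C \<subseteq> topspace (vtop E) \<and>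
    (\<forall>x\<in>C. \<forall>y\<in>C. \<forall>a b::'f. norm a + norm b \<le> 1 \<longrightarrow>
      vadd E (vscale E a x) (vscale E b y) \<in> C)"

definition closed_absolutely_convex_hull :: "('f::real_normed_field, 'v) tvs \<Rightarrow> 'v set \<Rightarrow> 'v set"
  where "closed_absolutely_convex_hull E S =
    (\<lambda>C. closedin (vtop E) C \<and> absolutely_convex E C) hull S"

definition separably_quasi_complete :: "('f::real_normed_field, 'v) tvs \<Rightarrow> bool"
  where "separably_quasi_complete E \<longleftrightarrow>
    (\<forall>A. closedin (vtop E) A \<and> separable_space (subtopology (vtop E) A) \<and> tvs_bounded E A \<longrightarrow>
      tvs_complete E A)"

definition sequentially_complete :: "('f::real_normed_field, 'v) tvs \<Rightarrow> bool"
  where "sequentially_complete E \<longleftrightarrow>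
    (\<forall>s. tvs_Cauchy E s \<longrightarrow> (\<exists>l. limitin (vtop E) s l sequentially))"

definition locally_complete :: "('f::real_normed_field, 'v) tvs \<Rightarrow> bool"
  where "locally_complete E \<longleftrightarrow>
    (\<forall>s. null_sequence E s \<longrightarrow> compactin (vtop E) (closed_absolutely_convex_hull E (range s)))"


text \<open>Functions on \<open>topspace X\<close> are represented by their extensional versions, as
  \<^const>\<open>product_topology\<close> requires.\<close>

definition Cp :: "'a topology \<Rightarrow> ('f::real_normed_field, 'a \<Rightarrow> 'f) tvs"
  where "Cp X = \<lparr>
    vtop = subtopology (product_topology (\<lambda>_. euclidean) (topspace X))
             {f. continuous_map X euclidean f},
    vadd = (\<lambda>f g. \<lambda>x\<in>topspace X. f x + g x),
    vzero = (\<lambda>x\<in>topspace X. 0),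
    vscale = (\<lambda>c f. \<lambda>x\<in>topspace X. c * f x)\<rparr>"

end

theory Submission
  imports Defs
begin

text \<open>
  All four properties of \<open>X\<close> are tied together by a fifth one: a pointwise limit \<open>h\<close> of
  continuous functions \<open>g n\<close> such that every sequence \<open>g 0 x, g 1 x, ...\<close> is eventually constant
  is itself continuous. Call this closure under stationary limits.

  In a \<open>P\<close>-space, fix a countable family \<open>D\<close> of continuous functions. Its common fibres are
  countable intersections of open sets, hence open, so every function that is constant on these
  fibres is continuous (\<open>continuous_map_factoring\<close>). Such functions form a set
  that is closed under arbitrary pointwise limits, even in the product of all functions, and it
  contains \<open>D\<close>, hence the closure of \<open>D\<close>. If \<open>D\<close> is
  dense in a separable closed subset of \<open>C\<^sub>p(X)\<close>, the pointwise limit of a Cauchy filter there is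
  therefore continuous, which gives separable quasi-completeness. If \<open>D\<close> is the range of a null
  sequence, cutting down the fibrewise constant functions to a product of discs gives an absolutely
  convex compact set around that range, which gives local completeness.

  Conversely, a sequence as above is Cauchy, so sequential completeness implies closure under
  stationary limits (and separable quasi-completeness implies sequential completeness, by passing to
  the closure of the range). For local completeness the weighted differences
  \<open>2^(k+1) * (g (k+1) - g k)\<close> form a null sequence, and \<open>g N - g 0\<close> is an absolutely convex combination
  of them; a compact hull is closed among all functions, so it contains \<open>h - g 0\<close>.

  Finally, closure under stationary limits forces \<open>X\<close> to be a \<open>P\<close>-space. Given open sets \<open>U n\<close>
  around \<open>x\<close>, complete regularity yields \<open>f n\<close> vanishing at \<open>x\<close> and equal to 1 outside \<open>U n\<close>, and the
  products of the functions \<open>max 0 (1 - n * f k)\<close> over \<open>k < n\<close> are eventually equal to the indicator of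
  the common zero set of the \<open>f k\<close> at every point. So this zero set is an open neighbourhood of \<open>x\<close>
  inside the intersection of the \<open>U n\<close>.

  The equivalences are proved for scalars in a normed field with compact closed balls, which covers
  the real and the complex case at once.
\<close>

section \<open>Pointwise descriptions of the notions for spaces of continuous functions\<close>

lemma topspace_Cp:
  "topspace (vtop (Cp X)) = {f \<in> extensional (topspace X). continuous_map X euclidean f}"
  by (auto simp: Cp_def PiE_def)

lemma vzero_Cp: "vzero (Cp X) = (\<lambda>x\<in>topspace X. 0)"
  by (simp add: Cp_def)

lemma vscale_Cp: "vscale (Cp X) c f = (\<lambda>x\<in>topspace X. c * f x)"
  by (simp add: Cp_def)

lemma vadd_Cp: "vadd (Cp X) f g = (\<lambda>x\<in>topspace X. f x + g x)"
  by (simp add: Cp_def)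

lemma vminus_Cp: "vminus (Cp X) f g = (\<lambda>x\<in>topspace X. f x - g x)"
  by (auto simp: Cp_def vminus_def)

lemma restrict_in_topspace_Cp:
  assumes "continuous_map X euclidean f"
  shows "(\<lambda>x\<in>topspace X. f x) \<in> topspace (vtop (Cp X))"
  using continuous_map_eq[OF assms, of "\<lambda>x\<in>topspace X. f x"] by (simp add: topspace_Cp)

lemma vzero_in_topspace_Cp: "vzero (Cp X) \<in> topspace (vtop (Cp X))"
  unfolding vzero_Cp by (intro restrict_in_topspace_Cp) simp

lemma continuous_map_mult_field:
  fixes f g :: "'a \<Rightarrow> 'f::real_normed_field"
  assumes "continuous_map X euclidean f" "continuous_map X euclidean g"
  shows "continuous_map X euclidean (\<lambda>x. f x * g x)"
  using assms by (simp add: continuous_map_atin tendsto_mult)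

lemma vminus_in_topspace_Cp:
  assumes "f \<in> topspace (vtop (Cp X))" "g \<in> topspace (vtop (Cp X))"
  shows "vminus (Cp X) f g \<in> topspace (vtop (Cp X))"
  using assms unfolding vminus_Cp
  by (intro restrict_in_topspace_Cp continuous_map_diff) (auto simp: topspace_Cp)

lemma vscale_in_topspace_Cp:
  assumes "f \<in> topspace (vtop (Cp X))"
  shows "vscale (Cp X) c f \<in> topspace (vtop (Cp X))"
  using assms unfolding vscale_Cp
  by (intro restrict_in_topspace_Cp continuous_map_mult_field) (auto simp: topspace_Cp)

lemma limitin_Cp:
  "limitin (vtop (Cp X)) s l F \<longleftrightarrow>
    l \<in> topspace (vtop (Cp X)) \<and> (\<forall>\<^sub>F n in F. s n \<in> topspace (vtop (Cp X))) \<and>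
    (\<forall>x\<in>topspace X. ((\<lambda>n. s n x) \<longlongrightarrow> l x) F)"
  unfolding topspace_Cp
  by (auto simp: Cp_def limitin_subtopology limitin_componentwise PiE_def eventually_conj_iff)

lemma continuous_map_Cp_eval:
  assumes "x \<in> topspace X"
  shows "continuous_map (vtop (Cp X)) euclidean (\<lambda>f. f x)"
  unfolding Cp_def tvs.simps
  by (intro continuous_map_from_subtopology continuous_map_product_projection assms)

lemma zero_nbhd_Cp_subbasic:
  assumes "x \<in> topspace X" "e > 0"
  shows "zero_nbhd (Cp X) {f \<in> topspace (vtop (Cp X)). norm (f x) < e}"
proof -
  have "openin (vtop (Cp X)) {f \<in> topspace (vtop (Cp X)). f x \<in> ball 0 e}"
    by (rule openin_continuous_map_preimage[OF continuous_map_Cp_eval[OF assms(1)]]) simp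
  then show ?thesis
    using assms vzero_in_topspace_Cp[of X] by (simp add: zero_nbhd_def vzero_Cp)
qed

text \<open>Reduces a condition on all neighbourhoods of zero to finitely many points of the domain.\<close>
lemma zero_nbhd_Cp_basis:
  fixes U :: "('a \<Rightarrow> 'f::real_normed_field) set"
  assumes "zero_nbhd (Cp X) U"
  obtains S e where "finite S" "S \<subseteq> topspace X" "e > 0"
    "{f \<in> topspace (vtop (Cp X)). \<forall>x\<in>S. norm (f x) < e} \<subseteq> U"
proof -
  let ?P = "product_topology (\<lambda>_. euclidean :: 'f topology) (topspace X)"
  obtain V where V: "openin ?P V" "U = V \<inter> {f. continuous_map X euclidean f}"
    using assms unfolding zero_nbhd_def Cp_def by (auto simp: openin_subtopology)
  have "(\<lambda>x\<in>topspace X. 0) \<in> V"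
    using assms V(2) by (auto simp: zero_nbhd_def vzero_Cp)
  then obtain W where W: "(\<lambda>x\<in>topspace X. 0) \<in> PiE (topspace X) W"
      "\<And>i. open (W i)" "finite {i. W i \<noteq> UNIV}" "PiE (topspace X) W \<subseteq> V"
    using product_topology_open_contains_basis[OF V(1)] by force
  define S where "S = {i \<in> topspace X. W i \<noteq> UNIV}"
  have S: "finite S" "S \<subseteq> topspace X"
    using W(3) by (auto simp: S_def)
  have "open (\<Inter>i\<in>S. W i)" "0 \<in> (\<Inter>i\<in>S. W i)"
    using S W(1,2) by (auto simp: open_INT PiE_iff restrict_def split: if_splits)
  then obtain e where e: "e > 0" "ball 0 e \<subseteq> (\<Inter>i\<in>S. W i)"
    by (meson open_contains_ball)
  have "f \<in> U" if "f \<in> topspace (vtop (Cp X))" and small: "\<forall>x\<in>S. norm (f x) < e" for f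
  proof -
    have "f i \<in> W i" if "i \<in> topspace X" for i
      using e(2) small that by (cases "i \<in> S") (auto simp: S_def subset_iff)
    then have "f \<in> PiE (topspace X) W"
      using that(1) by (auto simp: topspace_Cp PiE_iff)
    then show ?thesis
      using that(1) W(4) V(2) by (auto simp: topspace_Cp)
  qed
  then show ?thesis
    using that S e(1) by blast
qed

lemma tvs_Cauchy_Cp_iff:
  fixes s :: "nat \<Rightarrow> 'a \<Rightarrow> 'f::real_normed_field"
  shows "tvs_Cauchy (Cp X) s \<longleftrightarrow>
    range s \<subseteq> topspace (vtop (Cp X)) \<and> (\<forall>x\<in>topspace X. Cauchy (\<lambda>n. s n x))"
    (is "?L \<longleftrightarrow> ?R")
proof
  assume L: ?L
  have "\<exists>M. \<forall>m\<ge>M. \<forall>n\<ge>M. norm (s m x - s n x) < e"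
    if x: "x \<in> topspace X" and e: "e > 0" for x e
  proof -
    obtain M where "\<forall>m\<ge>M. \<forall>n\<ge>M.
        vminus (Cp X) (s m) (s n) \<in> {f \<in> topspace (vtop (Cp X)). norm (f x) < e}"
      using L zero_nbhd_Cp_subbasic[OF x e] unfolding tvs_Cauchy_def by blast
    then show ?thesis
      using x by (intro exI[of _ M]) (simp add: vminus_Cp)
  qed
  then show ?R
    using L by (simp add: tvs_Cauchy_def Cauchy_iff)
next
  assume R: ?R
  have "\<exists>N. \<forall>m\<ge>N. \<forall>n\<ge>N. vminus (Cp X) (s m) (s n) \<in> U" if "zero_nbhd (Cp X) U" for U
  proof -
    obtain S e where S: "finite S" "S \<subseteq> topspace X" "e > 0"
      "{f \<in> topspace (vtop (Cp X)). \<forall>x\<in>S. norm (f x) < e} \<subseteq> U"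
      using zero_nbhd_Cp_basis[OF \<open>zero_nbhd (Cp X) U\<close>] .
    have "\<forall>x\<in>S. \<exists>M. \<forall>m\<ge>M. \<forall>n\<ge>M. norm (s m x - s n x) < e"
      using R S by (auto simp: Cauchy_iff subset_iff)
    then obtain M where M: "\<And>x m n. \<lbrakk>x \<in> S; m \<ge> M x; n \<ge> M x\<rbrakk> \<Longrightarrow> norm (s m x - s n x) < e"
      by metis
    \<comment> \<open>The sum is a convenient common upper bound of the finitely many \<open>M x\<close>.\<close>
    have "vminus (Cp X) (s m) (s n) \<in> U" if "m \<ge> (\<Sum>x\<in>S. M x)" "n \<ge> (\<Sum>x\<in>S. M x)" for m n
    proof -
      have "norm (s m x - s n x) < e" if "x \<in> S" for x
        using member_le_sum[OF that, of M] S(1) that \<open>m \<ge> _\<close> \<open>n \<ge> _\<close> by (intro M) auto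
      moreover have "vminus (Cp X) (s m) (s n) \<in> topspace (vtop (Cp X))"
        using R by (intro vminus_in_topspace_Cp) auto
      ultimately show ?thesis
        using S(2,4) by (auto simp: vminus_Cp subset_iff)
    qed
    then show ?thesis
      by blast
  qed
  then show ?L
    using R by (simp add: tvs_Cauchy_def)
qed

text \<open>A neighbourhood of zero constrains finitely many points only, so pointwise bounds can be
  replaced by their maximum there.\<close>
lemma tvs_bounded_Cp:
  fixes B :: "('a \<Rightarrow> 'f::real_normed_field) set"
  assumes B: "B \<subseteq> topspace (vtop (Cp X))"
    and pointwise: "\<And>x. x \<in> topspace X \<Longrightarrow> bounded ((\<lambda>f. f x) ` B)"
  shows "tvs_bounded (Cp X) B"
proof -
  have "\<exists>r>0. \<forall>t::'f. norm t \<ge> r \<longrightarrow> B \<subseteq> vscale (Cp X) t ` U" if "zero_nbhd (Cp X) U" for U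
  proof -
    obtain S e where S: "finite S" "S \<subseteq> topspace X" "e > 0"
      "{f \<in> topspace (vtop (Cp X)). \<forall>x\<in>S. norm (f x) < e} \<subseteq> U"
      using zero_nbhd_Cp_basis[OF \<open>zero_nbhd (Cp X) U\<close>] .
    have "bounded (\<Union>x\<in>S. (\<lambda>f. f x) ` B)"
      using S pointwise by (intro bounded_UN) auto
    then obtain M where M: "M > 0" "\<And>x f. \<lbrakk>x \<in> S; f \<in> B\<rbrakk> \<Longrightarrow> norm (f x) \<le> M"
      unfolding bounded_pos by blast
    have "f \<in> vscale (Cp X) t ` U" if t: "norm t \<ge> (M + 1) / e" and f: "f \<in> B" for t :: 'f and f
    proof
      have "0 < (M + 1) / e"
        using M(1) S(3) by simp
      then have t0: "norm t > 0"
        using t by linarith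
      then have "t \<noteq> 0"
        by auto
      then show "f = vscale (Cp X) t (vscale (Cp X) (inverse t) f)"
        using f B by (auto simp: vscale_Cp topspace_Cp extensional_def fun_eq_iff)
      have "norm (inverse t * f x) < e" if "x \<in> S" for x
      proof -
        have "norm (f x) < norm t * e"
          using M(2)[OF that f] t S(3) by (simp add: divide_simps)
        then show ?thesis
          using t0 by (subst norm_mult, subst norm_inverse) (simp add: field_simps)
      qed
      moreover have "vscale (Cp X) (inverse t) f \<in> topspace (vtop (Cp X))"
        using f B by (intro vscale_in_topspace_Cp) auto
      ultimately show "vscale (Cp X) (inverse t) f \<in> U"
        using S(2,4) by (auto simp: vscale_Cp subset_iff)
    qed
    then show ?thesis
      using M(1) S(3) by (intro exI[of _ "(M + 1) / e"]) auto
  qed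
  then show ?thesis
    using B by (simp add: tvs_bounded_def)
qed

section \<open>P-spaces: functions constant on common fibres of a countable family\<close>

definition factoring :: "'a topology \<Rightarrow> ('a \<Rightarrow> 'f) set \<Rightarrow> ('a \<Rightarrow> 'f) set"
  where "factoring X D = {h. \<forall>x\<in>topspace X. \<forall>y\<in>topspace X.
    (\<forall>d\<in>D. d x = d y) \<longrightarrow> h x = h y}"

lemma factoringD:
  assumes "h \<in> factoring X D" "x \<in> topspace X" "y \<in> topspace X" "\<forall>d\<in>D. d x = d y"
  shows "h x = h y"
  using assms unfolding factoring_def by blast

lemma subset_factoring: "D \<subseteq> factoring X D"
  by (auto simp: factoring_def)

text \<open>Continuity is local constancy here: each point has its common fibre as a neighbourhood.\<close>
lemma continuous_map_factoring:
  fixes D :: "('a \<Rightarrow> 'f::real_normed_field) set"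
  assumes P: "P_space X" and D: "countable D" "\<And>d. d \<in> D \<Longrightarrow> continuous_map X euclidean d"
    and h: "h \<in> factoring X D"
  shows "continuous_map X euclidean h"
proof -
  have fibre_open: "openin X {y \<in> topspace X. \<forall>d\<in>D. d y = d x}" for x
  proof -
    define V where
      "V = (\<lambda>(d::'a \<Rightarrow> 'f, n). {y \<in> topspace X. d y \<in> ball (d x) (inverse (real (Suc n)))})"
    \<comment> \<open>The whole space is added because an intersection over an empty \<open>D\<close> would not stay inside
      the space.\<close>
    have "openin X (\<Inter>(insert (topspace X) (V ` (D \<times> UNIV))))"
    proof -
      have "\<forall>U \<in> insert (topspace X) (V ` (D \<times> UNIV)). openin X U"
        using openin_continuous_map_preimage[OF D(2)] by (auto simp: V_def simp del: mem_ball)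
      moreover have "countable (insert (topspace X) (V ` (D \<times> UNIV)))"
        using D(1) by auto
      ultimately show ?thesis
        using P unfolding P_space_def by blast
    qed
    moreover have "\<Inter>(insert (topspace X) (V ` (D \<times> UNIV))) =
        {y \<in> topspace X. \<forall>d\<in>D. d y = d x}"
    proof -
      have "a = b" if "\<And>n. dist b a < inverse (real (Suc n))" for a b :: 'f
      proof (rule ccontr)
        assume "a \<noteq> b"
        then obtain n where "inverse (real (Suc n)) < dist b a"
          using reals_Archimedean[of "dist b a"] by auto
        then show False
          using that[of n] by simp
      qed
      then show ?thesis
        by (auto simp: V_def)
    qed
    ultimately show ?thesis
      by simp
  qed
  have "openin X {y \<in> topspace X. h y \<in> U}" for U
  proof (subst openin_subopen, intro ballI)
    fix x assume x: "x \<in> {y \<in> topspace X. h y \<in> U}"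
    have "{y \<in> topspace X. \<forall>d\<in>D. d y = d x} \<subseteq> {y \<in> topspace X. h y \<in> U}"
    proof
      fix y assume y: "y \<in> {y \<in> topspace X. \<forall>d\<in>D. d y = d x}"
      then have "h y = h x"
        using x by (intro factoringD[OF h]) auto
      then show "y \<in> {y \<in> topspace X. h y \<in> U}"
        using x y by simp
    qed
    then show "\<exists>T. openin X T \<and> x \<in> T \<and> T \<subseteq> {y \<in> topspace X. h y \<in> U}"
      using fibre_open[of x] x by blast
  qed
  then show ?thesis
    by (simp add: continuous_map_def)
qed

lemma limit_in_factoring:
  fixes D :: "('a \<Rightarrow> 'f::real_normed_field) set"
  assumes "F \<noteq> bot" and ev: "\<forall>\<^sub>F g in F. g \<in> factoring X D"
    and lim: "\<And>x. x \<in> topspace X \<Longrightarrow> ((\<lambda>g. g x) \<longlongrightarrow> l x) F"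
  shows "l \<in> factoring X D"
proof -
  have "l x = l y" if xy: "x \<in> topspace X" "y \<in> topspace X" "\<forall>d\<in>D. d x = d y" for x y
  proof -
    have "\<forall>\<^sub>F g in F. g x = g y"
      using ev by eventually_elim (rule factoringD[OF _ xy])
    then have "((\<lambda>g. g y) \<longlongrightarrow> l x) F"
      using lim[OF xy(1)] tendsto_cong by fast
    then show ?thesis
      using tendsto_unique[OF assms(1)] lim[OF xy(2)] by blast
  qed
  then show ?thesis
    unfolding factoring_def by blast
qed

lemma closedin_Cp_factoring:
  fixes D :: "('a \<Rightarrow> 'f::real_normed_field) set"
  shows "closedin (vtop (Cp X)) (topspace (vtop (Cp X)) \<inter> factoring X D)"
proof -
  let ?T = "vtop (Cp X) :: ('a \<Rightarrow> 'f) topology"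
  let ?R = "{(x, y) \<in> topspace X \<times> topspace X. \<forall>d\<in>D. d x = d y}"
  have "topspace ?T \<inter> factoring X D =
      \<Inter>(insert (topspace ?T) ((\<lambda>(x, y). {f \<in> topspace ?T. f x = f y}) ` ?R))"
    by (auto simp: factoring_def)
  moreover
  have "closedin ?T {f \<in> topspace ?T. f x = f y}"
    if "x \<in> topspace X" "y \<in> topspace X" for x y
    using that by (intro closedin_continuous_maps_eq[OF Hausdorff_space_euclidean]
        continuous_map_Cp_eval)
  then have "closedin ?T (\<Inter>(insert (topspace ?T) ((\<lambda>(x, y). {f \<in> topspace ?T. f x = f y}) ` ?R)))"
    by (intro closedin_Inter) auto
  ultimately show ?thesis
    by simp
qed

text \<open>The set is a closed subset of a product of compact discs, and by
  \<open>continuous_map_factoring\<close> it consists of continuous functions only.\<close>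
lemma compactin_Cp_bounded_factoring:
  fixes D :: "('a \<Rightarrow> 'f::{real_normed_field, heine_borel}) set"
  assumes P: "P_space X" and D: "countable D" "\<And>d. d \<in> D \<Longrightarrow> continuous_map X euclidean d"
  shows "compactin (vtop (Cp X)) (PiE (topspace X) (\<lambda>x. cball 0 (M x)) \<inter> factoring X D)"
proof -
  let ?P = "product_topology (\<lambda>_. euclidean :: 'f topology) (topspace X)"
  let ?B = "PiE (topspace X) (\<lambda>x. cball (0::'f) (M x))"
  let ?R = "{(x, y) \<in> topspace X \<times> topspace X. \<forall>d\<in>D. d x = d y}"
  have B: "compactin ?P ?B"
    by (simp add: compactin_PiE)
  have eq: "?B \<inter> factoring X D =
      \<Inter>(insert ?B ((\<lambda>(x, y). {f \<in> topspace ?P. f x = f y}) ` ?R))"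
    by (auto simp: factoring_def PiE_iff)
  have B_closed: "closedin ?P ?B"
    by (intro compactin_imp_closedin B) (simp add: Hausdorff_space_product_topology)
  have "closedin ?P {f \<in> topspace ?P. f x = f y}"
    if "x \<in> topspace X" "y \<in> topspace X" for x y
    using that by (intro closedin_continuous_maps_eq[OF Hausdorff_space_euclidean]
        continuous_map_product_projection[of _ _ "\<lambda>_. euclidean", simplified])
  with B_closed
  have "closedin ?P (\<Inter>(insert ?B ((\<lambda>(x, y). {f \<in> topspace ?P. f x = f y}) ` ?R)))"
    by (intro closedin_Inter) auto
  then have "closedin ?P (?B \<inter> factoring X D)"
    by (simp only: eq)
  then have "compactin ?P (?B \<inter> factoring X D)"
    by (rule closed_compactin[OF B Int_lower1])
  moreover have "factoring X D \<subseteq> {f. continuous_map X euclidean f}"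
    using continuous_map_factoring[OF P D(1)] D(2) by blast
  then have "?B \<inter> factoring X D \<subseteq> {f. continuous_map X euclidean f}"
    by (rule subset_trans[OF Int_lower2])
  ultimately show ?thesis
    by (simp add: Cp_def compactin_subtopology)
qed

text \<open>A Cauchy filter on a separable set has a pointwise limit that still factors through a
  countable dense subset, because every member of the set does; so the limit is continuous.\<close>
lemma P_space_imp_separably_quasi_complete:
  fixes X :: "'a topology"
  assumes P: "P_space X"
  shows "separably_quasi_complete (Cp X :: ('f::{real_normed_field, heine_borel}, 'a \<Rightarrow> 'f) tvs)"
proof -
  let ?E = "Cp X :: ('f, 'a \<Rightarrow> 'f) tvs"
  have "\<exists>a\<in>A. limitin (vtop ?E) (\<lambda>x. x) a F"
    if A: "closedin (vtop ?E) A" and sep: "separable_space (subtopology (vtop ?E) A)"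
      and F: "F \<noteq> bot" "F \<le> principal A" "tvs_cauchy_filter ?E F" for A F
  proof -
    have A_sub: "A \<subseteq> topspace (vtop ?E)"
      using A closedin_subset by blast
    obtain D where D: "countable D" "D \<subseteq> A" "subtopology (vtop ?E) A closure_of D = A"
      using sep A_sub unfolding separable_space_def by (auto simp: Int_absorb1)
    have D_cont: "continuous_map X euclidean d" if "d \<in> D" for d
      using that D(2) A_sub by (auto simp: topspace_Cp)
    have "A \<subseteq> vtop ?E closure_of D"
      using D(2,3) by (simp add: closure_of_subtopology Int_absorb1) blast
    also have "\<dots> \<subseteq> topspace (vtop ?E) \<inter> factoring X D"
      using D(2) A_sub subset_factoring[of D X]
      by (intro closure_of_minimal closedin_Cp_factoring) auto
    finally have A_fac: "A \<subseteq> factoring X D"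
      by blast
    have ev_A: "\<forall>\<^sub>F g in F. g \<in> A"
      using F(2) by (simp add: le_principal)
    have "\<exists>c. ((\<lambda>g. g x) \<longlongrightarrow> c) F" if x: "x \<in> topspace X" for x
    proof -
      have "cauchy_filter (filtermap (\<lambda>g. g x) F)"
        unfolding cauchy_filter_metric_filtermap
      proof (intro allI impI)
        fix e :: real assume "e > 0"
        then obtain S where S: "\<forall>\<^sub>F g in F. g \<in> S"
          "\<forall>f\<in>S. \<forall>g\<in>S. vminus ?E f g \<in> {f \<in> topspace (vtop ?E). norm (f x) < e}"
          using F(3) zero_nbhd_Cp_subbasic[OF x \<open>e > 0\<close>] unfolding tvs_cauchy_filter_def by blast
        then show "\<exists>P. eventually P F \<and> (\<forall>f g. P f \<and> P g \<longrightarrow> dist (f x) (g x) < e)"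
          using x by (intro exI[of _ "\<lambda>g. g \<in> S"]) (auto simp: vminus_Cp dist_norm)
      qed
      then show ?thesis
        using cauchy_filter_complete_converges[of "filtermap (\<lambda>g. g x) F" UNIV] F(1)
        by (auto simp: filterlim_def filtermap_bot_iff complete_UNIV)
    qed
    then obtain c where c: "\<And>x. x \<in> topspace X \<Longrightarrow> ((\<lambda>g. g x) \<longlongrightarrow> c x) F"
      by metis
    have "c \<in> factoring X D"
    proof (rule limit_in_factoring[OF F(1) _ c])
      show "\<forall>\<^sub>F g in F. g \<in> factoring X D"
        using ev_A by eventually_elim (use A_fac in blast)
    qed
    then have "continuous_map X euclidean c"
      using continuous_map_factoring[OF P D(1)] D_cont by blast
    moreover have "\<forall>\<^sub>F g in F. g \<in> topspace (vtop ?E)"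
      using ev_A by eventually_elim (use A_sub in blast)
    ultimately have lim: "limitin (vtop ?E) (\<lambda>x. x) (\<lambda>x\<in>topspace X. c x) F"
      using c by (simp add: limitin_Cp restrict_in_topspace_Cp)
    then have "(\<lambda>x\<in>topspace X. c x) \<in> A"
      using limitin_closedin[OF lim A ev_A] F(1) by (simp add: trivial_limit_def)
    then show ?thesis
      using lim by blast
  qed
  then have "tvs_complete ?E A"
    if "closedin (vtop ?E) A" "separable_space (subtopology (vtop ?E) A)" for A
    using that closedin_subset[OF that(1)] unfolding tvs_complete_def by blast
  then show ?thesis
    unfolding separably_quasi_complete_def by blast
qed

text \<open>A null sequence is pointwise bounded, say by \<open>M\<close>. The functions that are bounded by \<open>M\<close> and
  constant on the common fibres of the sequence form a compact absolutely convex set, which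
  therefore contains the hull.\<close>
lemma P_space_imp_locally_complete:
  fixes X :: "'a topology"
  assumes P: "P_space X"
  shows "locally_complete (Cp X :: ('f::{real_normed_field, heine_borel}, 'a \<Rightarrow> 'f) tvs)"
proof -
  let ?E = "Cp X :: ('f, 'a \<Rightarrow> 'f) tvs"
  have "compactin (vtop ?E) (closed_absolutely_convex_hull ?E (range s))"
    if s: "null_sequence ?E s" for s
  proof -
    have s_sub: "s n \<in> topspace (vtop ?E)" for n
      using s by (auto simp: null_sequence_def)
    have "\<exists>M. \<forall>n. norm (s n x) \<le> M" if x: "x \<in> topspace X" for x
    proof -
      have "(\<lambda>n. s n x) \<longlonglongrightarrow> 0"
        using s x by (auto simp: null_sequence_def limitin_Cp vzero_Cp)
      then have "bounded (range (\<lambda>n. s n x))"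
        by (rule convergent_imp_bounded)
      then show ?thesis
        by (auto simp: bounded_iff)
    qed
    then obtain M where M: "\<And>x n. x \<in> topspace X \<Longrightarrow> norm (s n x) \<le> M x"
      by metis
    define K where "K = PiE (topspace X) (\<lambda>x. cball (0::'f) (M x)) \<inter> factoring X (range s)"
    have K: "compactin (vtop ?E) K"
      unfolding K_def using s_sub by (intro compactin_Cp_bounded_factoring[OF P])
        (auto simp: topspace_Cp)
    have K_sub: "K \<subseteq> topspace (vtop ?E)"
      using K compactin_subset_topspace by blast
    have "Hausdorff_space (vtop ?E)"
      by (simp add: Cp_def Hausdorff_space_product_topology Hausdorff_space_subtopology)
    then have K_closed: "closedin (vtop ?E) K"
      using K compactin_imp_closedin by blast
    have "absolutely_convex ?E K"
      unfolding absolutely_convex_def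
    proof (intro conjI ballI allI impI K_sub)
      fix f g and a b :: 'f
      assume f: "f \<in> K" and g: "g \<in> K" and ab: "norm a + norm b \<le> 1"
      have "norm (a * f x + b * g x) \<le> M x" if x: "x \<in> topspace X" for x
      proof -
        have le: "norm (f x) \<le> M x" "norm (g x) \<le> M x"
          using f g x by (auto simp: K_def PiE_iff)
        then have "0 \<le> M x"
          using norm_ge_zero order_trans by blast
        have "norm (a * f x + b * g x) \<le> norm a * norm (f x) + norm b * norm (g x)"
          by (metis norm_mult norm_triangle_ineq)
        also have "\<dots> \<le> norm a * M x + norm b * M x"
          using le by (intro add_mono mult_left_mono) auto
        also have "\<dots> \<le> M x"
          using mult_right_mono[OF ab \<open>0 \<le> M x\<close>] by (simp add: algebra_simps)
        finally show ?thesis .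
      qed
      moreover have "(\<lambda>x\<in>topspace X. a * f x + b * g x) \<in> factoring X (range s)"
        unfolding factoring_def
      proof (intro CollectI ballI impI)
        fix x y assume xy: "x \<in> topspace X" "y \<in> topspace X" "\<forall>d\<in>range s. d x = d y"
        have "f x = f y" "g x = g y"
          using f g by (auto simp: K_def intro: factoringD[OF _ xy])
        then show "(\<lambda>x\<in>topspace X. a * f x + b * g x) x = (\<lambda>x\<in>topspace X. a * f x + b * g x) y"
          using xy(1,2) by simp
      qed
      ultimately show "vadd ?E (vscale ?E a f) (vscale ?E b g) \<in> K"
        by (auto simp: K_def vadd_Cp vscale_Cp cong: restrict_cong)
    qed
    moreover have "range s \<subseteq> K"
      using s_sub M subset_factoring[of "range s" X]
      by (auto simp: K_def PiE_iff topspace_Cp intro: extensional_arb)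
    ultimately have "closed_absolutely_convex_hull ?E (range s) \<subseteq> K"
      unfolding closed_absolutely_convex_hull_def by (intro hull_minimal) (use K_closed in auto)
    moreover have "closedin (vtop ?E) (closed_absolutely_convex_hull ?E (range s))"
      unfolding closed_absolutely_convex_hull_def hull_def
      by (intro closedin_Inter) (use K_closed \<open>absolutely_convex ?E K\<close> \<open>range s \<subseteq> K\<close> in auto)
    ultimately show ?thesis
      using closed_compactin[OF K] by blast
  qed
  then show ?thesis
    by (simp add: locally_complete_def)
qed

section \<open>Completeness implies closure under stationary limits\<close>

text \<open>The type argument selects the scalars, which do not occur in the type of \<open>X\<close>.\<close>
definition stationary_limits_continuous :: "'a topology \<Rightarrow> 'f::real_normed_field itself \<Rightarrow> bool"
  where "stationary_limits_continuous X _ \<longleftrightarrow>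
    (\<forall>(g :: nat \<Rightarrow> 'a \<Rightarrow> 'f) h. (\<forall>n. continuous_map X euclidean (g n)) \<and>
      (\<forall>x\<in>topspace X. \<forall>\<^sub>F n in sequentially. g n x = h x) \<longrightarrow> continuous_map X euclidean h)"

text \<open>The closure of the range of a Cauchy sequence has the range as a countable dense subset, and it
  inherits the pointwise bounds of the sequence, because discs are closed. So it is complete.\<close>
lemma separably_quasi_complete_imp_sequentially_complete:
  fixes X :: "'a topology"
  assumes "separably_quasi_complete (Cp X :: ('f::real_normed_field, 'a \<Rightarrow> 'f) tvs)"
  shows "sequentially_complete (Cp X :: ('f, 'a \<Rightarrow> 'f) tvs)"
proof -
  let ?E = "Cp X :: ('f, 'a \<Rightarrow> 'f) tvs"
  have "\<exists>l. limitin (vtop ?E) s l sequentially" if s: "tvs_Cauchy ?E s" for s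
  proof -
    let ?A = "vtop ?E closure_of range s"
    have s_sub: "range s \<subseteq> topspace (vtop ?E)"
      using s by (simp add: tvs_Cauchy_def)
    then have s_A: "range s \<subseteq> ?A"
      by (rule closure_of_subset)
    have "separable_space (subtopology (vtop ?E) ?A)"
      unfolding separable_space_def
    proof (intro exI[of _ "range s"] conjI)
      show "subtopology (vtop ?E) ?A closure_of range s = topspace (subtopology (vtop ?E) ?A)"
        using s_A closure_of_subset_topspace[of "vtop ?E" "range s"]
        by (simp add: closure_of_subtopology Int_absorb1 Int_absorb2)
    qed (use s_A s_sub in auto)
    moreover have "tvs_bounded ?E ?A"
    proof (rule tvs_bounded_Cp)
      fix x assume x: "x \<in> topspace X"
      have "bounded (range (\<lambda>n. s n x))"
        using s x by (intro cauchy_imp_bounded) (simp add: tvs_Cauchy_Cp_iff)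
      then obtain M where M: "\<And>n. norm (s n x) \<le> M"
        by (auto simp: bounded_iff)
      have cl: "closedin (vtop ?E) {f \<in> topspace (vtop ?E). f x \<in> cball 0 M}"
        by (rule closedin_continuous_map_preimage[OF continuous_map_Cp_eval[OF x]]) simp
      have "f x \<in> cball 0 M" if "f \<in> ?A" for f
        by (rule forall_in_closure_of[OF that _ cl]) (use M in auto)
      then show "bounded ((\<lambda>f. f x) ` ?A)"
        by (auto simp: bounded_iff)
    qed (rule closure_of_subset_topspace)
    ultimately have complete: "tvs_complete ?E ?A"
      using assms by (simp add: separably_quasi_complete_def)
    have "tvs_cauchy_filter ?E (filtermap s sequentially)"
      unfolding tvs_cauchy_filter_def
    proof (intro allI impI)
      fix U assume "zero_nbhd ?E U"
      then obtain N where "\<forall>m\<ge>N. \<forall>n\<ge>N. vminus ?E (s m) (s n) \<in> U"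
        using s unfolding tvs_Cauchy_def by meson
      then show "\<exists>S. (\<forall>\<^sub>F f in filtermap s sequentially. f \<in> S) \<and>
          (\<forall>f\<in>S. \<forall>g\<in>S. vminus ?E f g \<in> U)"
        by (intro exI[of _ "s ` {N..}"])
          (auto simp: eventually_filtermap eventually_sequentially intro!: exI[of _ N])
    qed
    moreover have "filtermap s sequentially \<le> principal ?A"
      using s_A by (simp add: le_principal eventually_filtermap image_subset_iff)
    ultimately obtain a where "limitin (vtop ?E) (\<lambda>x. x) a (filtermap s sequentially)"
      using complete unfolding tvs_complete_def by (meson filtermap_bot_iff sequentially_bot)
    then show ?thesis
      by (auto simp: limitin_def eventually_filtermap)
  qed
  then show ?thesis
    by (simp add: sequentially_complete_def)
qed

lemma sequentially_complete_imp_stationary_limits_continuous: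
  fixes X :: "'a topology"
  assumes sc: "sequentially_complete (Cp X :: ('f::real_normed_field, 'a \<Rightarrow> 'f) tvs)"
  shows "stationary_limits_continuous X TYPE('f)"
  unfolding stationary_limits_continuous_def
proof (intro allI impI, elim conjE)
  let ?E = "Cp X :: ('f, 'a \<Rightarrow> 'f) tvs"
  fix g :: "nat \<Rightarrow> 'a \<Rightarrow> 'f" and h
  assume g: "\<forall>n. continuous_map X euclidean (g n)"
    and h: "\<forall>x\<in>topspace X. \<forall>\<^sub>F n in sequentially. g n x = h x"
  define s where "s n = (\<lambda>x\<in>topspace X. g n x)" for n
  have lim_h: "(\<lambda>n. s n x) \<longlonglongrightarrow> h x" if "x \<in> topspace X" for x
    using h that by (simp add: s_def tendsto_eventually)
  have "tvs_Cauchy ?E s"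
    unfolding tvs_Cauchy_Cp_iff
    using g lim_h by (auto simp: s_def restrict_in_topspace_Cp intro: LIMSEQ_imp_Cauchy)
  then obtain l where l: "limitin (vtop ?E) s l sequentially"
    using sc by (auto simp: sequentially_complete_def)
  have "l x = h x" if "x \<in> topspace X" for x
    using l lim_h[OF that] that by (auto simp: limitin_Cp intro: LIMSEQ_unique)
  then show "continuous_map X euclidean h"
    using l by (intro continuous_map_eq[of X euclidean l h]) (auto simp: limitin_Cp topspace_Cp)
qed

text \<open>Pulling out the first term leaves half a sum of the same shape for the shifted sequence,
  which is why the statement is proved for all shifts \<open>j\<close> simultaneously.\<close>
lemma dyadic_combination_in_absolutely_convex:
  fixes C :: "('a \<Rightarrow> 'f::real_normed_field) set"
  assumes C: "absolutely_convex (Cp X) C" and s: "\<And>n. s n \<in> C"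
  shows "(\<lambda>x\<in>topspace X. \<Sum>k<m. s (j + k) x / 2 ^ Suc k) \<in> C"
proof (induction m arbitrary: j)
  case 0
  have "vadd (Cp X) (vscale (Cp X) 0 (s 0)) (vscale (Cp X) 0 (s 0)) \<in> C"
    using C s unfolding absolutely_convex_def by (metis norm_zero add_0 zero_le_one)
  then show ?case
    by (simp add: vadd_Cp vscale_Cp restrict_def cong: if_cong)
next
  case (Suc m)
  let ?t = "\<lambda>x\<in>topspace X. \<Sum>k<m. s (Suc j + k) x / 2 ^ Suc k"
  have "norm (1/2 :: 'f) + norm (1/2 :: 'f) \<le> 1"
    by (simp add: norm_divide)
  then have "vadd (Cp X) (vscale (Cp X) (1/2) (s j)) (vscale (Cp X) (1/2) ?t) \<in> C"
    using C s[of j] Suc.IH[of "Suc j"] unfolding absolutely_convex_def by blast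
  also have "vadd (Cp X) (vscale (Cp X) (1/2) (s j)) (vscale (Cp X) (1/2) ?t) =
      (\<lambda>x\<in>topspace X. \<Sum>k<Suc m. s (j + k) x / 2 ^ Suc k)"
  proof (rule ext)
    fix x
    have "(\<Sum>k<Suc m. s (j + k) x / 2 ^ Suc k) =
        1/2 * s j x + 1/2 * (\<Sum>k<m. s (Suc j + k) x / 2 ^ Suc k)"
      by (subst sum.lessThan_Suc_shift) (simp add: sum_distrib_left del: sum.lessThan_Suc)
    then show "vadd (Cp X) (vscale (Cp X) (1/2) (s j)) (vscale (Cp X) (1/2) ?t) x =
        (\<lambda>x\<in>topspace X. \<Sum>k<Suc m. s (j + k) x / 2 ^ Suc k) x"
      by (simp add: vadd_Cp vscale_Cp del: sum.lessThan_Suc)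
  qed
  finally show ?case .
qed

text \<open>Stationarity lets the differences of consecutive terms stay null after multiplication by any
  weights; the weights \<open>2 ^ Suc k\<close> make the telescoping sums absolutely convex combinations.\<close>
lemma locally_complete_imp_stationary_limits_continuous:
  fixes X :: "'a topology"
  assumes lc: "locally_complete (Cp X :: ('f::real_normed_field, 'a \<Rightarrow> 'f) tvs)"
  shows "stationary_limits_continuous X TYPE('f)"
  unfolding stationary_limits_continuous_def
proof (intro allI impI, elim conjE)
  let ?E = "Cp X :: ('f, 'a \<Rightarrow> 'f) tvs"
  let ?P = "product_topology (\<lambda>_. euclidean :: 'f topology) (topspace X)"
  fix g :: "nat \<Rightarrow> 'a \<Rightarrow> 'f" and h
  assume g: "\<forall>n. continuous_map X euclidean (g n)"
    and h: "\<forall>x\<in>topspace X. \<forall>\<^sub>F n in sequentially. g n x = h x"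
  define s where "s k = (\<lambda>x\<in>topspace X. 2 ^ Suc k * (g (Suc k) x - g k x))" for k
  have s_sub: "s k \<in> topspace (vtop ?E)" for k
    unfolding s_def using g
    by (intro restrict_in_topspace_Cp continuous_map_mult_field continuous_map_diff) auto
  have "(\<lambda>k. s k x) \<longlonglongrightarrow> 0" if x: "x \<in> topspace X" for x
  proof (rule tendsto_eventually)
    have ev: "\<forall>\<^sub>F n in sequentially. g n x = h x"
      using h x by blast
    then have "\<forall>\<^sub>F n in sequentially. g (Suc n) x = h x"
      by (simp add: eventually_sequentially_Suc[of "\<lambda>n. g n x = h x"])
    with ev show "\<forall>\<^sub>F k in sequentially. s k x = 0"
      by eventually_elim (simp add: s_def x)
  qed
  then have "null_sequence ?E s"
    using s_sub vzero_in_topspace_Cp[of X] by (auto simp: null_sequence_def limitin_Cp vzero_Cp)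
  define C where "C = closed_absolutely_convex_hull ?E (range s)"
  have "compactin (vtop ?E) C"
    using lc \<open>null_sequence ?E s\<close> by (simp add: locally_complete_def C_def)
  then have C: "compactin ?P C" "C \<subseteq> {f. continuous_map X euclidean f}"
    by (auto simp: Cp_def compactin_subtopology)
  \<comment> \<open>Compactness makes the hull closed among all functions, not only among continuous ones.\<close>
  have C_closed: "closedin ?P C"
    using C(1) by (intro compactin_imp_closedin) (simp add: Hausdorff_space_product_topology)
  have "s k \<in> C" for k
    unfolding C_def closed_absolutely_convex_hull_def using hull_subset by fast
  moreover have "absolutely_convex ?E C"
    unfolding absolutely_convex_def
  proof (intro conjI ballI allI impI)
    show "C \<subseteq> topspace (vtop ?E)"
      using \<open>compactin (vtop ?E) C\<close> by (rule compactin_subset_topspace)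
    fix f g and a b :: 'f
    assume fg: "f \<in> C" "g \<in> C" and ab: "norm a + norm b \<le> 1"
    show "vadd ?E (vscale ?E a f) (vscale ?E b g) \<in> C"
      unfolding C_def closed_absolutely_convex_hull_def hull_def
    proof (rule InterI)
      fix K assume K: "K \<in> {K. (closedin (vtop ?E) K \<and> absolutely_convex ?E K) \<and> range s \<subseteq> K}"
      then have "f \<in> K" "g \<in> K"
        using fg unfolding C_def closed_absolutely_convex_hull_def hull_def by blast+
      then show "vadd ?E (vscale ?E a f) (vscale ?E b g) \<in> K"
        using K ab unfolding absolutely_convex_def by blast
    qed
  qed
  ultimately have "(\<lambda>x\<in>topspace X. \<Sum>k<n. s (0 + k) x / 2 ^ Suc k) \<in> C" for n
    by (intro dyadic_combination_in_absolutely_convex)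
  moreover have "(\<Sum>k<n. s (0 + k) x / 2 ^ Suc k) = g n x - g 0 x" if "x \<in> topspace X" for n x
    using that by (simp add: s_def sum_lessThan_telescope[of "\<lambda>k. g k x"] del: power_Suc)
  ultimately have "(\<lambda>x\<in>topspace X. g n x - g 0 x) \<in> C" for n
    by (simp cong: restrict_cong)
  moreover have "limitin ?P (\<lambda>n. \<lambda>x\<in>topspace X. g n x - g 0 x)
      (\<lambda>x\<in>topspace X. h x - g 0 x) sequentially"
    using h by (auto simp: limitin_componentwise intro!: tendsto_diff tendsto_eventually)
  ultimately have "(\<lambda>x\<in>topspace X. h x - g 0 x) \<in> C"
    using limitin_closedin[OF _ C_closed] always_eventually sequentially_bot by blast
  then have "continuous_map X euclidean (\<lambda>x\<in>topspace X. h x - g 0 x)"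
    using C(2) by blast
  then have "continuous_map X euclidean (\<lambda>x. h x - g 0 x)"
    by (rule continuous_map_eq) simp
  then have "continuous_map X euclidean (\<lambda>x. h x - g 0 x + g 0 x)"
    using g by (intro continuous_map_add) auto
  then show "continuous_map X euclidean h"
    by (rule continuous_map_eq) simp
qed

section \<open>Closure under stationary limits characterises P-spaces\<close>

lemma continuous_map_prod_field:
  fixes f :: "'i \<Rightarrow> 'a \<Rightarrow> 'f::real_normed_field"
  assumes "\<And>i. i \<in> I \<Longrightarrow> continuous_map X euclidean (f i)"
  shows "continuous_map X euclidean (\<lambda>x. \<Prod>i\<in>I. f i x)"
  using assms by (simp add: continuous_map_atin tendsto_prod)

text \<open>Taking \<open>n\<close> both as the number of factors and as their steepness makes the product vanish at
  \<open>y\<close> from some index on as soon as a single \<open>f k y\<close> is positive; on the common zero set all factors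
  are 1. So the products have the indicator of this zero set as a stationary limit.\<close>
lemma stationary_limits_continuous_imp_P_space:
  fixes X :: "'a topology"
  assumes X: "tychonoff_space X"
    and lim: "stationary_limits_continuous X TYPE('f::real_normed_field)"
  shows "P_space X"
proof -
  have "openin X (\<Inter>\<U>)"
    if \<U>: "countable \<U>" "\<U> \<noteq> {}" "\<forall>U\<in>\<U>. openin X U" for \<U>
  proof (subst openin_subopen, intro ballI)
    fix x assume x: "x \<in> \<Inter>\<U>"
    obtain U :: "nat \<Rightarrow> 'a set" where U: "range U = \<U>"
      using \<U>(1,2) by (metis range_from_nat_into)
    have U_open: "openin X (U k)" and x_U: "x \<in> U k" for k
      using U \<U>(3) x by auto
    have x_X: "x \<in> topspace X"
      using U_open[of 0] x_U[of 0] openin_subset by blast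
    have "\<exists>f::'a \<Rightarrow> real. continuous_map X (top_of_set {0..1}) f \<and> f x = 0 \<and>
        f ` (topspace X - U k) \<subseteq> {1}" for k
      using X x_X x_U[of k] U_open[of k]
      unfolding tychonoff_space_def completely_regular_space_def by blast
    then obtain f :: "nat \<Rightarrow> 'a \<Rightarrow> real" where f: "\<And>k. continuous_map X (top_of_set {0..1}) (f k)"
      "\<And>k. f k x = 0" "\<And>k. f k ` (topspace X - U k) \<subseteq> {1}"
      by metis
    have f_cont: "continuous_map X euclidean (f k)" and f_ge0: "y \<in> topspace X \<Longrightarrow> f k y \<ge> 0"
      for k y
      using f(1)[of k] by (auto simp: continuous_map_in_subtopology)
    define Z where "Z = {y \<in> topspace X. \<forall>k. f k y = 0}"
    define g :: "nat \<Rightarrow> 'a \<Rightarrow> 'f" where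
      "g n y = (\<Prod>k<n. of_real (max 0 (1 - real n * f k y)))" for n y
    have "continuous_map X euclidean (g n)" for n
    proof -
      have "continuous_map X euclidean (\<lambda>y. max 0 (1 - real n * f k y))" for k
        using f_cont by (intro continuous_intros) auto
      then have "continuous_map X euclidean (\<lambda>y. of_real (max 0 (1 - real n * f k y)) :: 'f)" for k
        by (auto simp: continuous_map_atin intro!: tendsto_of_real)
      then show ?thesis
        unfolding g_def by (intro continuous_map_prod_field)
    qed
    moreover have "\<forall>\<^sub>F n in sequentially. g n y = indicator Z y" if y: "y \<in> topspace X" for y
    proof (cases "y \<in> Z")
      case True
      then show ?thesis
        by (simp add: g_def Z_def)
    next
      case False
      then obtain k where "f k y > 0"
        using y f_ge0[OF y] unfolding Z_def by (auto simp: less_le)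
      then obtain N where N: "real N * f k y > 1"
        using reals_Archimedean3 by blast
      have "g n y = 0" if n: "n \<ge> N + Suc k" for n
      proof -
        have "real N * f k y \<le> real n * f k y"
          using n \<open>f k y > 0\<close> by (intro mult_right_mono) auto
        then have "max 0 (1 - real n * f k y) = 0"
          using N by simp
        moreover have "k < n"
          using n by simp
        ultimately show ?thesis
          unfolding g_def by (intro prod_zero) (auto intro!: bexI[of _ k])
      qed
      then show ?thesis
        using False by (auto simp: eventually_sequentially)
    qed
    ultimately have "continuous_map X euclidean (indicator Z :: 'a \<Rightarrow> 'f)"
      using lim unfolding stationary_limits_continuous_def by blast
    then have "openin X {y \<in> topspace X. (indicator Z y :: 'f) \<in> - {0}}"
      by (rule openin_continuous_map_preimage) (simp add: open_Compl)
    also have "{y \<in> topspace X. (indicator Z y :: 'f) \<in> - {0}} = Z"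
      by (auto simp: Z_def indicator_def)
    finally have "openin X Z" .
    moreover have "x \<in> Z"
      using x_X f(2) by (simp add: Z_def)
    moreover have "y \<in> U k" if "y \<in> Z" for y k
    proof (rule ccontr)
      assume "y \<notin> U k"
      then have "f k y = 1"
        using f(3)[of k] that by (auto simp: Z_def)
      then show False
        using that by (simp add: Z_def)
    qed
    ultimately show "\<exists>T. openin X T \<and> x \<in> T \<and> T \<subseteq> \<Inter>\<U>"
      using U by (intro exI[of _ Z]) auto
  qed
  then show ?thesis
    using X by (simp add: P_space_def)
qed

lemma P_space_iff_completeness_of_Cp:
  fixes X :: "'a topology"
  assumes "tychonoff_space X"
  shows "(P_space X \<longleftrightarrow>
      separably_quasi_complete (Cp X :: ('f::{real_normed_field, heine_borel}, 'a \<Rightarrow> 'f) tvs)) \<and>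
    (P_space X \<longleftrightarrow> sequentially_complete (Cp X :: ('f, 'a \<Rightarrow> 'f) tvs)) \<and>
    (P_space X \<longleftrightarrow> locally_complete (Cp X :: ('f, 'a \<Rightarrow> 'f) tvs))"
    (is "(_ \<longleftrightarrow> ?ii) \<and> (_ \<longleftrightarrow> ?iii) \<and> (_ \<longleftrightarrow> ?iv)")
proof -
  have "?ii" if "P_space X"
    using that by (rule P_space_imp_separably_quasi_complete)
  moreover have "?iii" if "?ii"
    using that by (rule separably_quasi_complete_imp_sequentially_complete)
  moreover have "P_space X" if "?iii"
    by (rule stationary_limits_continuous_imp_P_space[OF assms
          sequentially_complete_imp_stationary_limits_continuous[OF that]])
  moreover have "?iv" if "P_space X"
    using that by (rule P_space_imp_locally_complete)
  moreover have "P_space X" if "?iv"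
    by (rule stationary_limits_continuous_imp_P_space[OF assms
          locally_complete_imp_stationary_limits_continuous[OF that]])
  ultimately show ?thesis
    by argo
qed

theorem theorem3p15:
  fixes X :: "'a topology"
  assumes "tychonoff_space X"
  shows "((P_space X \<longleftrightarrow> separably_quasi_complete (Cp X :: (real, 'a \<Rightarrow> real) tvs)) \<and>
          (P_space X \<longleftrightarrow> sequentially_complete (Cp X :: (real, 'a \<Rightarrow> real) tvs)) \<and>
          (P_space X \<longleftrightarrow> locally_complete (Cp X :: (real, 'a \<Rightarrow> real) tvs))) \<and>
         ((P_space X \<longleftrightarrow> separably_quasi_complete (Cp X :: (complex, 'a \<Rightarrow> complex) tvs)) \<and>
          (P_space X \<longleftrightarrow> sequentially_complete (Cp X :: (complex, 'a \<Rightarrow> complex) tvs)) \<and>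
          (P_space X \<longleftrightarrow> locally_complete (Cp X :: (complex, 'a \<Rightarrow> complex) tvs)))"
  by (intro conjI[OF P_space_iff_completeness_of_Cp P_space_iff_completeness_of_Cp] assms)

end
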